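(* Let $G$ be a regular edge-transitive graph of degree at least $1$ and let $v\in V(G)$. Let $\gamma_0$ be the fractional perfect matching with $\gamma_0(e)=\frac{1}{\deg(v)}$ for every $e\in E(G)$. Then $\gamma_0$ has the maximum fractional forcing number, i.e. $f_G(\gamma)\le f_G(\gamma_0)$ for every $\gamma\in\mathcal{P}_f(G)$.
   Context: Graphs are finite, simple and undirected. A graph is edge-transitive if for all edges $e,e'$ there is a graph automorphism mapping $e$ to $e'$. A fractional matching of $G$ is a function $\alpha:E(G)\to\mathbb{R}^{\ge 0}$ with $\sum_{e\ni v}\alpha(e)\le 1$ for every $v\in V(G)$; it is a fractional perfect matching if equality holds at every $v$. $\mathcal{P}_f(G)$ denotes the set of all fractional perfect matchings of $G$. Write $\|\alpha\|_1=\sum_{e\in E(G)}|\alpha(e)|$, and $\alpha\preceq\gamma$ if $\alpha(e)\le\gamma(e)$ for all $e\in E(G)$. For a fractional matching $\alpha$ and $\gamma\in\mathcal{P}_f(G)$, write $\alpha\uparrow\gamma$ if $\alpha\preceq\gamma$ and $\gamma$ is the only element $\gamma'$ of $\mathcal{P}_f(G)$ with $\alpha\preceq\gamma'$. The fractional forcing number of $\gamma$ is $f_G(\gamma)=\inf\{\|\alpha\|_1:\alpha\uparrow\gamma\}$. *)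

theory Defs
  imports Complex_Main "HOL-Library.FuncSet"
begin

text \<open>A graph is given by its vertex set \<open>V\<close> and its edge set \<open>E\<close>, an edge being the two-element
  set of its ends. Functions on \<open>E(G)\<close> are represented as extensional functions on \<open>E\<close>
  (they are \<open>undefined\<close> outside \<open>E\<close>), so that equality of such functions is equality on \<open>E\<close>.\<close>

definition simple_graph :: "'a set \<Rightarrow> 'a set set \<Rightarrow> bool" where
  "simple_graph V E \<longleftrightarrow> finite V \<and> (\<forall>e\<in>E. e \<subseteq> V \<and> card e = 2)"

definition degree :: "'a set set \<Rightarrow> 'a \<Rightarrow> nat" where
  "degree E v = card {e \<in> E. v \<in> e}"

definition regular_graph :: "'a set \<Rightarrow> 'a set set \<Rightarrow> bool" where
  "regular_graph V E \<longleftrightarrow> (\<forall>u\<in>V. \<forall>w\<in>V. degree E u = degree E w)"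

definition graph_automorphism :: "'a set \<Rightarrow> 'a set set \<Rightarrow> ('a \<Rightarrow> 'a) \<Rightarrow> bool" where
  "graph_automorphism V E \<sigma> \<longleftrightarrow>
     bij_betw \<sigma> V V \<and> (\<forall>x\<in>V. \<forall>y\<in>V. {x, y} \<in> E \<longleftrightarrow> {\<sigma> x, \<sigma> y} \<in> E)"

definition edge_transitive :: "'a set \<Rightarrow> 'a set set \<Rightarrow> bool" where
  "edge_transitive V E \<longleftrightarrow>
     (\<forall>e\<in>E. \<forall>e'\<in>E. \<exists>\<sigma>. graph_automorphism V E \<sigma> \<and> \<sigma> ` e = e')"

definition fractional_matchings :: "'a set \<Rightarrow> 'a set set \<Rightarrow> ('a set \<Rightarrow> real) set" where
  "fractional_matchings V E =
     {\<alpha> \<in> E \<rightarrow>\<^sub>E {0..}. \<forall>v\<in>V. (\<Sum>e | e \<in> E \<and> v \<in> e. \<alpha> e) \<le> 1}"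

definition fractional_perfect_matchings :: "'a set \<Rightarrow> 'a set set \<Rightarrow> ('a set \<Rightarrow> real) set" where
  "fractional_perfect_matchings V E =
     {\<alpha> \<in> fractional_matchings V E. \<forall>v\<in>V. (\<Sum>e | e \<in> E \<and> v \<in> e. \<alpha> e) = 1}"

definition norm1 :: "'a set set \<Rightarrow> ('a set \<Rightarrow> real) \<Rightarrow> real" where
  "norm1 E \<alpha> = (\<Sum>e\<in>E. \<bar>\<alpha> e\<bar>)"

definition le_on_edges :: "'a set set \<Rightarrow> ('a set \<Rightarrow> real) \<Rightarrow> ('a set \<Rightarrow> real) \<Rightarrow> bool" where
  "le_on_edges E \<alpha> \<gamma> \<longleftrightarrow> (\<forall>e\<in>E. \<alpha> e \<le> \<gamma> e)"

text \<open>The relation \<open>\<alpha> \<up> \<gamma>\<close>.\<close>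

definition forces :: "'a set \<Rightarrow> 'a set set \<Rightarrow> ('a set \<Rightarrow> real) \<Rightarrow> ('a set \<Rightarrow> real) \<Rightarrow> bool" where
  "forces V E \<alpha> \<gamma> \<longleftrightarrow>
     \<alpha> \<in> fractional_matchings V E \<and> \<gamma> \<in> fractional_perfect_matchings V E \<and> le_on_edges E \<alpha> \<gamma> \<and>
     (\<forall>\<gamma>' \<in> fractional_perfect_matchings V E. le_on_edges E \<alpha> \<gamma>' \<longrightarrow> \<gamma>' = \<gamma>)"

definition fractional_forcing_number :: "'a set \<Rightarrow> 'a set set \<Rightarrow> ('a set \<Rightarrow> real) \<Rightarrow> real" where
  "fractional_forcing_number V E \<gamma> = Inf {norm1 E \<alpha> |\<alpha>. forces V E \<alpha> \<gamma>}"

text \<open>The real infimum above is a genuine one: the set is bounded below, and it is nonempty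
  because every fractional perfect matching forces itself.\<close>

lemma forcing_norms_bdd_below: "bdd_below {norm1 E \<alpha> |\<alpha>. forces V E \<alpha> \<gamma>}"
  by (rule bdd_belowI[of _ 0]) (auto simp: norm1_def intro: sum_nonneg)

lemma fractional_perfect_matching_forces_itself:
  assumes G: "simple_graph V E" and g: "\<gamma> \<in> fractional_perfect_matchings V E"
  shows "forces V E \<gamma> \<gamma>"
proof -
  have "E \<subseteq> Pow V" and "finite V"
    using G by (auto simp: simple_graph_def)
  then have fin: "finite E"
    by (meson finite_Pow_iff finite_subset)
  have "\<gamma>' = \<gamma>" if g': "\<gamma>' \<in> fractional_perfect_matchings V E" and le: "le_on_edges E \<gamma> \<gamma>'" for \<gamma>'
  proof (rule PiE_ext)
    show "\<gamma>' \<in> E \<rightarrow>\<^sub>E {0..}" "\<gamma> \<in> E \<rightarrow>\<^sub>E {0..}"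
      using g g' by (auto simp: fractional_perfect_matchings_def fractional_matchings_def)
    fix e assume e: "e \<in> E"
    then have "e \<subseteq> V" "card e = 2"
      using G by (simp_all add: simple_graph_def)
    then obtain v where v: "v \<in> e" "v \<in> V"
      by (metis card.empty ex_in_conv subsetD zero_neq_numeral)
    let ?S = "{e \<in> E. v \<in> e}"
    have "sum \<gamma> ?S = sum \<gamma>' ?S"
      using g g' v by (simp add: fractional_perfect_matchings_def)
    then have "(\<Sum>e\<in>?S. \<gamma>' e - \<gamma> e) = 0"
      by (simp add: sum_subtractf)
    moreover have "\<forall>e\<in>?S. 0 \<le> \<gamma>' e - \<gamma> e"
      using le by (simp add: le_on_edges_def)
    ultimately have "\<forall>e\<in>?S. \<gamma>' e - \<gamma> e = 0"
      using fin sum_nonneg_eq_0_iff[of ?S "\<lambda>e. \<gamma>' e - \<gamma> e"] by simp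
    then show "\<gamma>' e = \<gamma> e"
      using e v by simp
  qed
  then show ?thesis
    using g by (auto simp: forces_def le_on_edges_def fractional_perfect_matchings_def)
qed

end

theory Submission
  imports Defs "HOL-Combinatorics.Permutations"
begin

text \<open>Whether \<open>\<alpha>\<close> forces \<open>\<gamma>\<close> is essentially a property of the set \<open>S\<close> of edges on which they agree.
  If \<open>\<gamma>\<close> can be moved at all above \<open>\<alpha>\<close>, it can be moved along a direction \<open>\<delta>\<close> whose sum at every
  vertex vanishes and which is nonnegative on \<open>S\<close>; conversely every such direction yields a
  legitimate small move, because off \<open>S\<close> there is room below \<open>\<gamma>\<close>. The condition that no such
  \<open>\<delta> \<noteq> 0\<close> exists (here: \<open>S\<close> is rigid) no longer mentions \<open>\<gamma>\<close>. So if \<open>\<alpha>\<close> forces \<open>\<gamma>\<^sub>0\<close>, then the same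
  \<open>S\<close>, and with it each image of \<open>S\<close> under an automorphism, bounds the forcing number of every other
  \<open>\<gamma>\<close> by the weight that \<open>\<gamma>\<close> gives to it (\<open>rigid_if_forces\<close>, \<open>forcing_number_le_rigid_weight\<close>,
  \<open>rigid_image\<close>).

  By edge-transitivity the images of \<open>S\<close> under the automorphism group cover all edges equally often,
  so the average of their \<open>\<gamma>\<close>-weights is \<open>card S / card E\<close> times the total weight of \<open>\<gamma>\<close>
  (\<open>exists_light_image\<close>). The total weight of a fractional perfect matching is half the number of
  vertices (\<open>perfect_matching_weight\<close>), hence the same for \<open>\<gamma>\<close> as for \<open>\<gamma>\<^sub>0\<close>, and the average is
  \<open>card S / deg v\<close>. This is the weight of \<open>\<gamma>\<^sub>0\<close> on \<open>S\<close>, which is at most the norm of \<open>\<alpha>\<close>.\<close>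

lemma simple_graph_finite_edges:
  assumes "simple_graph V E"
  shows "finite E"
proof (rule finite_subset)
  show "E \<subseteq> Pow V" "finite (Pow V)"
    using assms by (auto simp: simple_graph_def)
qed

text \<open>Every edge has two ends, so summing over the edges at each vertex counts it twice.\<close>

lemma handshake_sum:
  fixes g :: "'a set \<Rightarrow> real"
  assumes G: "simple_graph V E"
  shows "(\<Sum>v\<in>V. \<Sum>e | e \<in> E \<and> v \<in> e. g e) = 2 * sum g E"
proof -
  have finV: "finite V" and finE: "finite E"
    using G simple_graph_finite_edges by (auto simp: simple_graph_def)
  have "(\<Sum>v\<in>V. \<Sum>e | e \<in> E \<and> v \<in> e. g e) = (\<Sum>e\<in>E. \<Sum>v | v \<in> V \<and> v \<in> e. g e)"
    by (rule sum.swap_restrict[OF finV finE])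
  also have "\<dots> = (\<Sum>e\<in>E. 2 * g e)"
  proof (rule sum.cong[OF refl])
    fix e assume "e \<in> E"
    then have "{v. v \<in> V \<and> v \<in> e} = e" "card e = 2"
      using G by (auto simp: simple_graph_def)
    then show "(\<Sum>v | v \<in> V \<and> v \<in> e. g e) = 2 * g e"
      by simp
  qed
  finally show ?thesis
    by (simp add: sum_distrib_left)
qed

lemma perfect_matching_weight:
  assumes "simple_graph V E" and "\<gamma> \<in> fractional_perfect_matchings V E"
  shows "2 * sum \<gamma> E = real (card V)"
  using handshake_sum[OF assms(1), of \<gamma>] assms(2)
  by (simp add: fractional_perfect_matchings_def)

section \<open>Rigid edge sets\<close>

definition rigid :: "'a set \<Rightarrow> 'a set set \<Rightarrow> 'a set set \<Rightarrow> bool" where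
  "rigid V E S \<longleftrightarrow> S \<subseteq> E \<and>
     (\<forall>\<delta> :: 'a set \<Rightarrow> real. (\<forall>v\<in>V. (\<Sum>e | e \<in> E \<and> v \<in> e. \<delta> e) = 0) \<longrightarrow> (\<forall>e\<in>S. 0 \<le> \<delta> e)
        \<longrightarrow> (\<forall>e\<in>E. \<delta> e = 0))"

text \<open>A direction that is nonnegative where \<open>\<alpha>\<close> is tight moves \<open>\<gamma>\<close>, for a small enough step, to
  another fractional perfect matching above \<open>\<alpha>\<close>: off the tight set the slack \<open>\<gamma> - \<alpha>\<close> is positive,
  and finitely many edges admit a common step.\<close>

lemma rigid_if_forces:
  assumes G: "simple_graph V E" and f: "forces V E \<alpha> \<gamma>"
  shows "rigid V E {e \<in> E. \<alpha> e = \<gamma> e}"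
  unfolding rigid_def
proof (intro conjI allI impI)
  show "{e \<in> E. \<alpha> e = \<gamma> e} \<subseteq> E" by auto
  fix \<delta> :: "'a set \<Rightarrow> real"
  assume ker: "\<forall>v\<in>V. (\<Sum>e | e \<in> E \<and> v \<in> e. \<delta> e) = 0"
    and tight: "\<forall>e\<in>{e \<in> E. \<alpha> e = \<gamma> e}. 0 \<le> \<delta> e"
  have finE: "finite E"
    using G by (rule simple_graph_finite_edges)
  have \<alpha>0: "0 \<le> \<alpha> e" and le: "\<alpha> e \<le> \<gamma> e" if "e \<in> E" for e
  proof -
    have "\<alpha> \<in> fractional_matchings V E" "le_on_edges E \<alpha> \<gamma>"
      using f unfolding forces_def by blast+
    then show "0 \<le> \<alpha> e" "\<alpha> e \<le> \<gamma> e"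
      using that by (auto simp: fractional_matchings_def le_on_edges_def PiE_def Pi_def)
  qed
  have \<gamma>: "\<gamma> \<in> fractional_perfect_matchings V E"
    using f unfolding forces_def by blast
  \<comment> \<open>The \<open>1\<close> inserted into the set covers the case that \<open>\<alpha>\<close> is tight everywhere; the \<open>1\<close> in the
    denominator covers \<open>\<delta> e = 0\<close>.\<close>
  define \<epsilon> where
    "\<epsilon> = Min (insert 1 ((\<lambda>e. (\<gamma> e - \<alpha> e) / (\<bar>\<delta> e\<bar> + 1)) ` {e \<in> E. \<alpha> e \<noteq> \<gamma> e}))"
  have \<epsilon>: "0 < \<epsilon>"
    unfolding \<epsilon>_def
  proof (subst Min_gr_iff)
    show "\<forall>x\<in>insert 1 ((\<lambda>e. (\<gamma> e - \<alpha> e) / (\<bar>\<delta> e\<bar> + 1)) ` {e \<in> E. \<alpha> e \<noteq> \<gamma> e}). 0 < x"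
      using le by (auto simp: less_le intro!: divide_pos_pos)
  qed (use finE in auto)
  have above: "\<alpha> e \<le> \<gamma> e + \<epsilon> * \<delta> e" if e: "e \<in> E" for e
  proof (cases "\<alpha> e = \<gamma> e")
    case True
    then show ?thesis using tight e \<epsilon> by simp
  next
    case False
    then have "\<epsilon> \<le> (\<gamma> e - \<alpha> e) / (\<bar>\<delta> e\<bar> + 1)"
      unfolding \<epsilon>_def using finE e by (intro Min_le) auto
    then have "\<epsilon> * (\<bar>\<delta> e\<bar> + 1) \<le> \<gamma> e - \<alpha> e"
      by (simp add: pos_le_divide_eq)
    moreover have "\<epsilon> * (- \<delta> e) \<le> \<epsilon> * (\<bar>\<delta> e\<bar> + 1)"
      using \<epsilon> by (intro mult_left_mono) auto
    ultimately show ?thesis by simp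
  qed
  define \<gamma>' where "\<gamma>' = (\<lambda>e\<in>E. \<gamma> e + \<epsilon> * \<delta> e)"
  have sums: "(\<Sum>e | e \<in> E \<and> v \<in> e. \<gamma>' e) = 1" if v: "v \<in> V" for v
  proof -
    have "(\<Sum>e | e \<in> E \<and> v \<in> e. \<gamma>' e) = (\<Sum>e | e \<in> E \<and> v \<in> e. \<gamma> e + \<epsilon> * \<delta> e)"
      by (rule sum.cong) (auto simp: \<gamma>'_def)
    also have "\<dots> = 1"
      using ker v \<gamma>
      by (simp add: sum.distrib fractional_perfect_matchings_def flip: sum_distrib_left)
    finally show ?thesis .
  qed
  have "\<gamma>' \<in> E \<rightarrow>\<^sub>E {0..}"
    using above \<alpha>0 by (fastforce simp: \<gamma>'_def)
  then have "\<gamma>' \<in> fractional_perfect_matchings V E"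
    using sums by (simp add: fractional_perfect_matchings_def fractional_matchings_def)
  moreover have "le_on_edges E \<alpha> \<gamma>'"
    using above by (simp add: le_on_edges_def \<gamma>'_def)
  ultimately have eq: "\<gamma>' = \<gamma>"
    using f unfolding forces_def by blast
  show "\<forall>e\<in>E. \<delta> e = 0"
  proof
    fix e assume "e \<in> E"
    then show "\<delta> e = 0"
      using fun_cong[OF eq, of e] \<epsilon> by (simp add: \<gamma>'_def)
  qed
qed

text \<open>The restriction of \<open>\<gamma>\<close> to a rigid set, extended by zero, forces \<open>\<gamma>\<close>: the difference to a
  competitor above it sums to zero at each vertex and is nonnegative on the rigid set.\<close>

lemma forcing_number_le_rigid_weight:
  assumes G: "simple_graph V E" and S: "rigid V E S"
    and \<gamma>: "\<gamma> \<in> fractional_perfect_matchings V E"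
  shows "fractional_forcing_number V E \<gamma> \<le> sum \<gamma> S"
proof -
  have finE: "finite E"
    using G by (rule simple_graph_finite_edges)
  have SE: "S \<subseteq> E"
    using S by (simp add: rigid_def)
  have \<gamma>0: "0 \<le> \<gamma> e" if "e \<in> E" for e
    using \<gamma> that
    by (auto simp: fractional_perfect_matchings_def fractional_matchings_def PiE_def Pi_def)
  define \<alpha> where "\<alpha> = (\<lambda>e\<in>E. if e \<in> S then \<gamma> e else 0)"
  have le: "\<alpha> e \<le> \<gamma> e" if "e \<in> E" for e
    using \<gamma>0 that by (simp add: \<alpha>_def)
  have "(\<Sum>e | e \<in> E \<and> v \<in> e. \<alpha> e) \<le> 1" if "v \<in> V" for v
  proof -
    have "(\<Sum>e | e \<in> E \<and> v \<in> e. \<alpha> e) \<le> (\<Sum>e | e \<in> E \<and> v \<in> e. \<gamma> e)"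
      by (rule sum_mono) (use le in auto)
    then show ?thesis
      using \<gamma> that by (simp add: fractional_perfect_matchings_def)
  qed
  moreover have "\<alpha> \<in> E \<rightarrow>\<^sub>E {0..}"
    using \<gamma>0 by (auto simp: \<alpha>_def)
  ultimately have \<alpha>: "\<alpha> \<in> fractional_matchings V E"
    by (simp add: fractional_matchings_def)
  have "\<gamma>' = \<gamma>"
    if \<gamma>': "\<gamma>' \<in> fractional_perfect_matchings V E" and above: "le_on_edges E \<alpha> \<gamma>'" for \<gamma>'
  proof (rule PiE_ext)
    show "\<gamma>' \<in> E \<rightarrow>\<^sub>E {0..}" "\<gamma> \<in> E \<rightarrow>\<^sub>E {0..}"
      using \<gamma> \<gamma>' by (auto simp: fractional_perfect_matchings_def fractional_matchings_def)
    have "\<forall>v\<in>V. (\<Sum>e | e \<in> E \<and> v \<in> e. \<gamma>' e - \<gamma> e) = 0"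
      using \<gamma> \<gamma>' by (simp add: sum_subtractf fractional_perfect_matchings_def)
    moreover have "0 \<le> \<gamma>' e - \<gamma> e" if "e \<in> S" for e
    proof -
      have "e \<in> E" using SE that by auto
      then have "\<alpha> e \<le> \<gamma>' e" using above by (simp add: le_on_edges_def)
      then show ?thesis using \<open>e \<in> E\<close> that by (simp add: \<alpha>_def)
    qed
    ultimately have "\<forall>e\<in>E. \<gamma>' e - \<gamma> e = 0"
      using S[unfolded rigid_def, THEN conjunct2, THEN spec, of "\<lambda>e. \<gamma>' e - \<gamma> e"] by blast
    then show "\<gamma>' e = \<gamma> e" if "e \<in> E" for e
      using that by auto
  qed
  then have "forces V E \<alpha> \<gamma>"
    using \<alpha> \<gamma> le unfolding forces_def le_on_edges_def by blast
  then have "fractional_forcing_number V E \<gamma> \<le> norm1 E \<alpha>"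
    unfolding fractional_forcing_number_def
    by (intro cInf_lower forcing_norms_bdd_below) auto
  also have "norm1 E \<alpha> = (\<Sum>e\<in>E. if e \<in> S then \<gamma> e else 0)"
    unfolding norm1_def by (rule sum.cong) (use \<gamma>0 in \<open>auto simp: \<alpha>_def\<close>)
  also have "\<dots> = sum \<gamma> S"
    using finE SE by (simp add: sum.inter_restrict[symmetric] Int_absorb1)
  finally show ?thesis .
qed

section \<open>The automorphism group acting on edges\<close>

text \<open>Automorphisms are taken to be the identity off \<open>V\<close>, which makes them a finite group.\<close>

definition automorphism_group :: "'a set \<Rightarrow> 'a set set \<Rightarrow> ('a \<Rightarrow> 'a) set" where
  "automorphism_group V E = {\<sigma>. \<sigma> permutes V \<and> (`) \<sigma> ` E = E}"

lemma automorphism_group_bij: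
  assumes "\<sigma> \<in> automorphism_group V E"
  shows "bij_betw ((`) \<sigma>) E E"
  using assms inj_on_image[of \<sigma> E]
  by (auto simp: automorphism_group_def bij_betw_def permutes_inj_on)

lemma edge_transitive_group:
  assumes G: "simple_graph V E" and tr: "edge_transitive V E" and "e \<in> E" "e' \<in> E"
  shows "\<exists>\<sigma>\<in>automorphism_group V E. \<sigma> ` e = e'"
proof -
  obtain \<sigma> where \<sigma>: "graph_automorphism V E \<sigma>" "\<sigma> ` e = e'"
    using tr \<open>e \<in> E\<close> \<open>e' \<in> E\<close> unfolding edge_transitive_def by blast
  define \<tau> where "\<tau> = (\<lambda>x. if x \<in> V then \<sigma> x else x)"
  have "bij_betw \<tau> V V"
    using \<sigma> by (simp add: graph_automorphism_def \<tau>_def cong: bij_betw_cong)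
  then have perm: "\<tau> permutes V"
    by (rule bij_imp_permutes) (simp add: \<tau>_def)
  have eq: "\<tau> ` d = \<sigma> ` d" if "d \<in> E" for d
  proof -
    have "d \<subseteq> V" using G that by (simp add: simple_graph_def)
    then show ?thesis by (intro image_cong) (auto simp: \<tau>_def)
  qed
  have sub: "(`) \<tau> ` E \<subseteq> E"
  proof
    fix d' assume "d' \<in> (`) \<tau> ` E"
    then obtain d where d: "d \<in> E" "d' = \<sigma> ` d"
      using eq by auto
    then have "d \<subseteq> V" "card d = 2"
      using G by (auto simp: simple_graph_def)
    then obtain x y where "d = {x, y}" "x \<in> V" "y \<in> V"
      by (auto simp: card_2_iff)
    then show "d' \<in> E"
      using \<sigma>(1) d by (auto simp: graph_automorphism_def)
  qed
  have "inj_on ((`) \<tau>) E"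
    using perm by (intro inj_on_image permutes_inj_on)
  then have "(`) \<tau> ` E = E"
    using endo_inj_surj[OF simple_graph_finite_edges[OF G] sub] by simp
  then have "\<tau> \<in> automorphism_group V E"
    using perm by (simp add: automorphism_group_def)
  moreover have "\<tau> ` e = e'"
    using eq \<sigma> \<open>e \<in> E\<close> by simp
  ultimately show ?thesis by blast
qed

text \<open>Pulling a direction back along \<open>\<sigma>\<close> turns its sum at \<open>\<sigma> v\<close> into a sum at \<open>v\<close>.\<close>

lemma rigid_image:
  assumes S: "rigid V E S" and \<sigma>: "\<sigma> \<in> automorphism_group V E"
  shows "rigid V E ((`) \<sigma> ` S)"
  unfolding rigid_def
proof (intro conjI allI impI)
  have img: "(`) \<sigma> ` E = E" and perm: "\<sigma> permutes V" and inj: "inj \<sigma>"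
    using \<sigma> by (auto simp: automorphism_group_def permutes_inj)
  show "(`) \<sigma> ` S \<subseteq> E"
    using S img by (auto simp: rigid_def)
  fix \<delta> :: "'a set \<Rightarrow> real"
  assume ker: "\<forall>v\<in>V. (\<Sum>e | e \<in> E \<and> v \<in> e. \<delta> e) = 0" and nn: "\<forall>e\<in>(`) \<sigma> ` S. 0 \<le> \<delta> e"
  have "(\<Sum>e | e \<in> E \<and> v \<in> e. \<delta> (\<sigma> ` e)) = 0" if v: "v \<in> V" for v
  proof -
    have "(`) \<sigma> ` {e. e \<in> E \<and> v \<in> e} = {e. e \<in> (`) \<sigma> ` E \<and> \<sigma> v \<in> e}"
      using inj_eq[OF inj] by (auto intro!: imageI)
    then have "bij_betw ((`) \<sigma>) {e. e \<in> E \<and> v \<in> e} {e. e \<in> E \<and> \<sigma> v \<in> e}"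
      using inj_on_image[OF permutes_inj_on[OF perm], of "{e. e \<in> E \<and> v \<in> e}"] img
      by (simp add: bij_betw_def)
    then have "(\<Sum>e | e \<in> E \<and> v \<in> e. \<delta> (\<sigma> ` e)) = (\<Sum>e | e \<in> E \<and> \<sigma> v \<in> e. \<delta> e)"
      by (rule sum.reindex_bij_betw)
    then show ?thesis
      using ker v perm by (simp add: permutes_in_image)
  qed
  then have "\<forall>e\<in>E. \<delta> (\<sigma> ` e) = 0"
    using S[unfolded rigid_def, THEN conjunct2, THEN spec, of "\<lambda>e. \<delta> (\<sigma> ` e)"] nn by blast
  then show "\<forall>e\<in>E. \<delta> e = 0"
    using img by (metis imageE)
qed

text \<open>The orbit sum \<open>h e = (\<Sum>\<sigma>. g (\<sigma> ` e))\<close> is unchanged when \<open>e\<close> is moved by the group, hence constant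
  on a single orbit \<open>E\<close>. So the mean over the group of the weights of the images of \<open>S\<close> is
  \<open>card S / card E\<close> times the total weight, and some image weighs at most the mean.\<close>

lemma exists_light_image:
  fixes g :: "'a set \<Rightarrow> real"
  assumes G: "simple_graph V E" and tr: "edge_transitive V E" and SE: "S \<subseteq> E"
  shows "\<exists>\<sigma>\<in>automorphism_group V E.
    real (card E) * sum g ((`) \<sigma> ` S) \<le> real (card S) * sum g E"
proof (rule ccontr)
  assume "\<not> ?thesis"
  then have heavy: "real (card S) * sum g E < real (card E) * sum g ((`) \<sigma> ` S)"
    if "\<sigma> \<in> automorphism_group V E" for \<sigma>
    using that by force
  let ?A = "automorphism_group V E"
  have "finite V"
    using G by (simp add: simple_graph_def)
  then have finA: "finite ?A"
    by (auto simp: automorphism_group_def intro: finite_subset[OF _ finite_permutations])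
  have "id \<in> ?A"
    by (simp add: automorphism_group_def permutes_id)
  define h where "h e = (\<Sum>\<sigma>\<in>?A. g (\<sigma> ` e))" for e
  have invariant: "h (\<tau> ` e) = h e" if \<tau>: "\<tau> \<in> ?A" for \<tau> e
  proof -
    have perm: "\<tau> permutes V" and img: "(`) \<tau> ` E = E"
      using \<tau> by (auto simp: automorphism_group_def)
    have comp: "\<sigma> \<circ> \<tau> \<in> ?A" if "\<sigma> \<in> ?A" for \<sigma>
    proof -
      have "(`) (\<sigma> \<circ> \<tau>) ` E = (`) \<sigma> ` ((`) \<tau> ` E)"
        by (simp add: image_comp comp_def)
      then show ?thesis
        using that perm img by (auto simp: automorphism_group_def intro: permutes_compose)
    qed
    have "inj_on (\<lambda>\<sigma>. \<sigma> \<circ> \<tau>) ?A"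
      using permutes_surj[OF perm] by (auto intro!: inj_onI simp: fun_eq_iff) (metis surjD)
    then have "bij_betw (\<lambda>\<sigma>. \<sigma> \<circ> \<tau>) ?A ?A"
      using endo_inj_surj[OF finA, of "\<lambda>\<sigma>. \<sigma> \<circ> \<tau>"] comp by (auto simp: bij_betw_def)
    then have "(\<Sum>\<sigma>\<in>?A. g ((\<sigma> \<circ> \<tau>) ` e)) = h e"
      unfolding h_def by (rule sum.reindex_bij_betw)
    then show ?thesis
      by (simp add: h_def image_comp)
  qed
  have weight: "(\<Sum>\<sigma>\<in>?A. sum g ((`) \<sigma> ` T)) = sum h T" if "T \<subseteq> E" for T
  proof -
    have "sum g ((`) \<sigma> ` T) = (\<Sum>e\<in>T. g (\<sigma> ` e))" if "\<sigma> \<in> ?A" for \<sigma>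
      using automorphism_group_bij[OF that] \<open>T \<subseteq> E\<close>
      by (subst sum.reindex) (auto simp: bij_betw_def intro: inj_on_subset)
    then have "(\<Sum>\<sigma>\<in>?A. sum g ((`) \<sigma> ` T)) = (\<Sum>\<sigma>\<in>?A. \<Sum>e\<in>T. g (\<sigma> ` e))"
      by simp
    also have "\<dots> = sum h T"
      unfolding h_def by (rule sum.swap)
    finally show ?thesis .
  qed
  obtain c where c: "\<And>e. e \<in> E \<Longrightarrow> h e = c"
    using edge_transitive_group[OF G tr] invariant by metis
  have "(\<Sum>\<sigma>\<in>?A. sum g ((`) \<sigma> ` E)) = real (card ?A) * sum g E"
    by (simp add: automorphism_group_def)
  then have total: "real (card ?A) * sum g E = real (card E) * c"
    using weight[of E] c by simp
  have "real (card ?A) * (real (card S) * sum g E)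
      < (\<Sum>\<sigma>\<in>?A. real (card E) * sum g ((`) \<sigma> ` S))"
    using sum_strict_mono[OF finA, of "\<lambda>_. real (card S) * sum g E"
        "\<lambda>\<sigma>. real (card E) * sum g ((`) \<sigma> ` S)"] heavy \<open>id \<in> ?A\<close> by auto
  also have "\<dots> = real (card E) * (real (card S) * c)"
    using weight[OF SE] c SE by (simp add: subset_eq flip: sum_distrib_left)
  also have "\<dots> = real (card ?A) * (real (card S) * sum g E)"
    using total by (simp add: mult.left_commute)
  finally show False by simp
qed

section \<open>The constant matching maximises the forcing number\<close>

theorem corollary4p3:
  fixes V :: "'a set" and E :: "'a set set" and v :: 'a and \<gamma>\<^sub>0 :: "'a set \<Rightarrow> real"
  assumes "simple_graph V E"
    and "regular_graph V E"
    and "edge_transitive V E"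
    and "v \<in> V"
    and "degree E v \<ge> 1"
    and "\<gamma>\<^sub>0 = (\<lambda>e\<in>E. 1 / real (degree E v))"
  shows "\<gamma>\<^sub>0 \<in> fractional_perfect_matchings V E \<and>
    (\<forall>\<gamma> \<in> fractional_perfect_matchings V E.
       fractional_forcing_number V E \<gamma> \<le> fractional_forcing_number V E \<gamma>\<^sub>0)"
proof (intro conjI ballI)
  note G = assms(1)
  define d where "d = real (degree E v)"
  have d: "d > 0" and \<gamma>\<^sub>0: "\<gamma>\<^sub>0 = (\<lambda>e\<in>E. 1 / d)"
    using assms(5,6) by (auto simp: d_def)
  have finE: "finite E"
    using G by (rule simple_graph_finite_edges)
  have "(\<Sum>e | e \<in> E \<and> u \<in> e. \<gamma>\<^sub>0 e) = 1" if "u \<in> V" for u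
  proof -
    have "degree E u = degree E v"
      using assms(2,4) that unfolding regular_graph_def by blast
    moreover have "(\<Sum>e | e \<in> E \<and> u \<in> e. \<gamma>\<^sub>0 e) = (\<Sum>e | e \<in> E \<and> u \<in> e. 1 / d)"
      by (rule sum.cong) (auto simp: \<gamma>\<^sub>0)
    ultimately show ?thesis
      using d by (simp add: d_def degree_def)
  qed
  moreover have "\<gamma>\<^sub>0 \<in> E \<rightarrow>\<^sub>E {0..}"
    using d by (auto simp: \<gamma>\<^sub>0)
  ultimately show pm0: "\<gamma>\<^sub>0 \<in> fractional_perfect_matchings V E"
    by (simp add: fractional_perfect_matchings_def fractional_matchings_def)
  fix \<gamma> assume pm: "\<gamma> \<in> fractional_perfect_matchings V E"
  have "sum \<gamma> E = sum \<gamma>\<^sub>0 E"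
    using perfect_matching_weight[OF G pm] perfect_matching_weight[OF G pm0] by simp
  then have total: "sum \<gamma> E = real (card E) / d"
    by (simp add: \<gamma>\<^sub>0)
  have "E \<noteq> {}"
    using assms(5) by (auto simp: degree_def)
  then have cardE: "real (card E) > 0"
    using finE by (simp add: card_gt_0_iff)
  have bound: "fractional_forcing_number V E \<gamma> \<le> norm1 E \<alpha>" if f: "forces V E \<alpha> \<gamma>\<^sub>0" for \<alpha>
  proof -
    define S where "S = {e \<in> E. \<alpha> e = \<gamma>\<^sub>0 e}"
    have rig: "rigid V E S"
      unfolding S_def by (rule rigid_if_forces[OF G f])
    have SE: "S \<subseteq> E"
      by (auto simp: S_def)
    obtain \<sigma> where \<sigma>: "\<sigma> \<in> automorphism_group V E"
      and light: "real (card E) * sum \<gamma> ((`) \<sigma> ` S) \<le> real (card S) * sum \<gamma> E"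
      using exists_light_image[OF G assms(3) SE] by blast
    have "fractional_forcing_number V E \<gamma> \<le> sum \<gamma> ((`) \<sigma> ` S)"
      by (rule forcing_number_le_rigid_weight[OF G rigid_image[OF rig \<sigma>] pm])
    also have "real (card E) * sum \<gamma> ((`) \<sigma> ` S) \<le> real (card E) * (real (card S) / d)"
      using light unfolding total by (simp add: mult.commute)
    then have "sum \<gamma> ((`) \<sigma> ` S) \<le> real (card S) / d"
      using cardE by (rule mult_left_le_imp_le)
    also have "real (card S) / d = (\<Sum>e\<in>S. 1 / d)"
      by simp
    also have "\<dots> = (\<Sum>e\<in>S. \<bar>\<alpha> e\<bar>)"
      using d by (intro sum.cong) (auto simp: S_def \<gamma>\<^sub>0)
    also have "\<dots> \<le> norm1 E \<alpha>"
      unfolding norm1_def by (rule sum_mono2[OF finE SE]) simp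
    finally show ?thesis .
  qed
  show "fractional_forcing_number V E \<gamma> \<le> fractional_forcing_number V E \<gamma>\<^sub>0"
    unfolding fractional_forcing_number_def[of V E \<gamma>\<^sub>0]
  proof (rule cInf_greatest)
    show "{norm1 E \<alpha> |\<alpha>. forces V E \<alpha> \<gamma>\<^sub>0} \<noteq> {}"
      using fractional_perfect_matching_forces_itself[OF G pm0] by blast
  qed (use bound in blast)
qed

end
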